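(* Every matrix $B\in\mathcal{B}_{R_{\mathrm{cube}}}$ is reducible with respect to $R_{\mathrm{cube}}$, where $$R_{\mathrm{cube}}=\frac12\begin{bmatrix} -I&I&I&I \\ I&-Z&I&Z \\ I&Z&-Z&I \\ I&I&Z&-Z \end{bmatrix}$$ and $I$, $Z=J-I$ are square matrices of order $2$.
   Context: $I$ is the identity matrix, $J$ the all-ones matrix and $O$ the zero matrix. An adjacency matrix is a symmetric $01$-matrix with zero diagonal. An orthogonal matrix is regular if each of its rows sums to $1$. The level of a rational matrix is the smallest positive integer $\ell$ such that $\ell$ times the matrix is integral. A matrix is decomposable if it can be written as a non-trivial block-diagonal matrix after some permutation of its rows and columns (rows and columns may be permuted independently), and indecomposable otherwise. For a regular orthogonal matrix $R$, $\mathcal{V}_R$ is the set of $01$-vectors $v$ such that $R^Tv$ is again a $01$-vector, and $\mathcal{B}_R$ is the set of adjacency matrices $B$ such that $R^TBR$ is again an adjacency matrix. Reducibility: let $R$ be an indecomposable regular orthogonal matrix of level $2$ and let $B\in\mathcal{B}_R$. Then $B$ is reducible with respect to $R$ if there are decomposable regular orthogonal matrices $R_1,\dots,R_s$ of the same order as $R$, each of level at most $2$ (in particular $R_i$ may have the form $\mathrm{diag}(R_i',I)$ with $R_i'$ a smaller regular orthogonal matrix, and may have several non-trivial blocks), such that $R=R_1\cdots R_s$ and such that for every $i<s$ and every adjacency matrix $A=\begin{bmatrix} B&V \\ V^T&W \end{bmatrix}$ all of whose columns of $V$ lie in $\mathcal{V}_R$, the matrix $(Q_1\cdots Q_i)^TA(Q_1\cdots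 Q_i)$ is an adjacency matrix, where $Q_k=\begin{bmatrix} R_k&O \\ O&I \end{bmatrix}$. *)

theory Defs
  imports "Jordan_Normal_Form.Matrix" "HOL-Combinatorics.Permutations"
begin

definition zero_one_mat :: "rat mat \<Rightarrow> bool" where
  "zero_one_mat A \<longleftrightarrow> (\<forall>i < dim_row A. \<forall>j < dim_col A. A $$ (i, j) \<in> {0, 1})"

definition zero_one_vec :: "rat vec \<Rightarrow> bool" where
  "zero_one_vec v \<longleftrightarrow> (\<forall>i < dim_vec v. v $ i \<in> {0, 1})"

definition adjacency_mat :: "rat mat \<Rightarrow> bool" where
  "adjacency_mat A \<longleftrightarrow> square_mat A \<and> transpose_mat A = A \<and> zero_one_mat A \<and>
     (\<forall>i < dim_row A. A $$ (i, i) = 0)"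

text \<open>
  The constant \<open>orthogonal_mat\<close> of the matrix library only asks for pairwise orthogonal nonzero
  columns; here the columns have to be orthonormal.
\<close>

definition regular_orthogonal_mat :: "rat mat \<Rightarrow> bool" where
  "regular_orthogonal_mat R \<longleftrightarrow> square_mat R \<and>
     transpose_mat R * R = 1\<^sub>m (dim_row R) \<and> R * transpose_mat R = 1\<^sub>m (dim_row R) \<and>
     (\<forall>i < dim_row R. (\<Sum>j < dim_col R. R $$ (i, j)) = 1)"

definition level :: "rat mat \<Rightarrow> nat" where
  "level M = (LEAST l. 0 < l \<and>
     (\<forall>i < dim_row M. \<forall>j < dim_col M. of_nat l * M $$ (i, j) \<in> \<int>))"

text \<open>
  It suffices to ask for two diagonal blocks, as further blocks can be merged. The notion is used
  for square matrices only, and the diagonal blocks are square.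
\<close>

definition decomposable_mat :: "rat mat \<Rightarrow> bool" where
  "decomposable_mat M \<longleftrightarrow> square_mat M \<and>
     (\<exists>p q D1 D2. p permutes {..<dim_row M} \<and> q permutes {..<dim_col M} \<and>
        square_mat D1 \<and> 0 < dim_row D1 \<and> square_mat D2 \<and> 0 < dim_row D2 \<and>
        mat (dim_row M) (dim_col M) (\<lambda>(i, j). M $$ (p i, q j)) = diag_block_mat [D1, D2])"

definition V_set :: "rat mat \<Rightarrow> rat vec set" where
  "V_set R = {v \<in> carrier_vec (dim_row R).
     zero_one_vec v \<and> zero_one_vec (transpose_mat R *\<^sub>v v)}"

definition B_set :: "rat mat \<Rightarrow> rat mat set" where
  "B_set R = {B \<in> carrier_mat (dim_row R) (dim_row R).
     adjacency_mat B \<and> adjacency_mat (transpose_mat R * B * R)}"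

definition mat_list_prod :: "nat \<Rightarrow> rat mat list \<Rightarrow> rat mat" where
  "mat_list_prod n Ms = foldr (*) Ms (1\<^sub>m n)"

text \<open>
  The number \<open>m\<close> of vertices outside \<open>B\<close> is arbitrary. The list \<open>Rs\<close> is the sequence
  \<open>R\<^sub>1, \<dots>, R\<^sub>s\<close>, and \<open>take i Rs\<close> is its initial segment \<open>R\<^sub>1, \<dots>, R\<^sub>i\<close>.
\<close>

definition reducible_wrt :: "rat mat \<Rightarrow> rat mat \<Rightarrow> bool" where
  "reducible_wrt R B \<longleftrightarrow>
     regular_orthogonal_mat R \<and> \<not> decomposable_mat R \<and> level R = 2 \<and> B \<in> B_set R \<and>
     (\<exists>Rs.
        (\<forall>S \<in> set Rs. S \<in> carrier_mat (dim_row R) (dim_row R) \<and>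
           regular_orthogonal_mat S \<and> decomposable_mat S \<and> level S \<le> 2) \<and>
        R = mat_list_prod (dim_row R) Rs \<and>
        (\<forall>i m V W. 1 \<le> i \<and> i < length Rs \<and>
           V \<in> carrier_mat (dim_row R) m \<and> W \<in> carrier_mat m m \<and>
           set (cols V) \<subseteq> V_set R \<and>
           adjacency_mat (four_block_mat B V (transpose_mat V) W) \<longrightarrow>
           (let A = four_block_mat B V (transpose_mat V) W;
                Q = mat_list_prod (dim_row R + m)
                  (map (\<lambda>S. four_block_mat S (0\<^sub>m (dim_row R) m) (0\<^sub>m m (dim_row R)) (1\<^sub>m m))
                    (take i Rs))
            in adjacency_mat (transpose_mat Q * A * Q))))"

definition R_cube :: "rat mat" where
  "R_cube = (1 / 2) \<cdot>\<^sub>m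
     (let I = 1\<^sub>m 2; Z = mat 2 2 (\<lambda>_. 1) - I;
          blocks = [[- I,   I,   I,   I],
                    [  I, - Z,   I,   Z],
                    [  I,   Z, - Z,   I],
                    [  I,   I,   Z, - Z]]
      in mat 8 8 (\<lambda>(i, j). (blocks ! (i div 2) ! (j div 2)) $$ (i mod 2, j mod 2)))"

end

theory Submission
  imports Defs
begin

text \<open>
  For \<open>A \<subseteq> {0, \<dots>, 7}\<close> with four elements let \<open>S\<^sub>A\<close> be the matrix \<open>J / 2 - I\<close> on \<open>A\<close>, extended by the
  identity. The vectors in \<open>V_set R_cube\<close> form the extended Hamming code, and eight of its codewords
  of weight 4 are transversals \<open>A\<close> of the pairs \<open>{2k, 2k + 1}\<close>; they form four complementary pairs
  \<open>A, C\<close>. For \<open>P = S\<^sub>A\<close> and for \<open>P = S\<^sub>A S\<^sub>C\<close>, both \<open>P\<close> and \<open>P\<^sup>T R_cube\<close> are decomposable of level 2,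
  and \<open>P\<^sup>T\<close> maps the code to 01-vectors. Hence \<open>R_cube = P (P\<^sup>T R_cube)\<close> shows reducibility of \<open>B\<close> as
  soon as \<open>P\<^sup>T B P\<close> is an adjacency matrix. That one of these twelve matrices \<open>P\<close> always works is found
  by a backtracking search over the 28 entries of \<open>B\<close> above the diagonal.
\<close>

section \<open>Decomposable matrices\<close>

text \<open>Bijections from the initial segment onto \<open>S\<close> and from the remaining indices
  onto its complement glue to a permutation.\<close>

lemma permutes_image_initial:
  assumes "S \<subseteq> {..<n}"
  shows "\<exists>p. p permutes {..<n} \<and> p ` {..<card S} = S"
proof -
  let ?k = "card S"
  have fin: "finite S" and k: "?k \<le> n"
    using assms finite_subset[OF assms] card_mono[OF finite_lessThan assms] by auto
  obtain f where f: "bij_betw f {..<?k} S"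
    using finite_same_card_bij[of "{..<?k}" S] fin by auto
  have "card {?k..<n} = card ({..<n} - S)"
    using assms fin by (simp add: card_Diff_subset)
  then obtain g where g: "bij_betw g {?k..<n} ({..<n} - S)"
    using finite_same_card_bij[of "{?k..<n}" "{..<n} - S"] by auto
  define p where "p i = (if i < ?k then f i else if i < n then g i else i)" for i
  have 1: "bij_betw p {..<?k} S"
    using f by (subst bij_betw_cong[of _ p f]) (auto simp: p_def)
  have 2: "bij_betw p {?k..<n} ({..<n} - S)"
    using g by (subst bij_betw_cong[of _ p g]) (auto simp: p_def)
  have "bij_betw p ({..<?k} \<union> {?k..<n}) (S \<union> ({..<n} - S))"
    by (rule bij_betw_combine[OF 1 2]) auto
  moreover have "{..<?k} \<union> {?k..<n} = {..<n}" "S \<union> ({..<n} - S) = {..<n}"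
    using k assms by auto
  ultimately have "p permutes {..<n}"
    by (intro bij_imp_permutes) (use k in \<open>auto simp: p_def\<close>)
  then show ?thesis
    using 1 by (auto simp: bij_betw_def)
qed

text \<open>Permutations that move \<open>S\<close> and \<open>T\<close> to the front expose the two
  blocks; equal cardinalities make the blocks square.\<close>

lemma decomposable_matI:
  assumes M: "M \<in> carrier_mat n n" and S: "S \<subseteq> {..<n}" and T: "T \<subseteq> {..<n}"
    and card: "card S = card T" "0 < card S" "card S < n"
    and zero: "\<And>i j. i < n \<Longrightarrow> j < n \<Longrightarrow> (i \<in> S) \<noteq> (j \<in> T) \<Longrightarrow> M $$ (i, j) = 0"
  shows "decomposable_mat M"
proof -
  let ?k = "card S"
  obtain p where p: "p permutes {..<n}" "p ` {..<?k} = S"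
    using permutes_image_initial[OF S] by auto
  obtain q where q: "q permutes {..<n}" "q ` {..<?k} = T"
    using permutes_image_initial[OF T] card by auto
  have mem: "p i \<in> S \<longleftrightarrow> i < ?k" "q i \<in> T \<longleftrightarrow> i < ?k" for i
    using inj_image_mem_iff[OF permutes_inj[OF p(1)], of i "{..<?k}"]
      inj_image_mem_iff[OF permutes_inj[OF q(1)], of i "{..<?k}"] p(2) q(2) by auto
  have less: "p i < n" "q i < n" if "i < n" for i
    using permutes_in_image[OF p(1), of i] permutes_in_image[OF q(1), of i] that by auto
  define D1 where "D1 = mat ?k ?k (\<lambda>(i, j). M $$ (p i, q j))"
  define D2 where "D2 = mat (n - ?k) (n - ?k) (\<lambda>(i, j). M $$ (p (i + ?k), q (j + ?k)))"
  have "mat n n (\<lambda>(i, j). M $$ (p i, q j)) = diag_block_mat [D1, D2]"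
  proof (rule eq_matI)
    fix i j assume "i < dim_row (diag_block_mat [D1, D2])" "j < dim_col (diag_block_mat [D1, D2])"
    then have ij: "i < n" "j < n"
      using card(3) by (simp_all add: D1_def D2_def Let_def)
    have "M $$ (p i, q j) = 0" if "(i < ?k) \<noteq> (j < ?k)"
      using zero[OF less(1)[OF ij(1)] less(2)[OF ij(2)]] that unfolding mem by blast
    then show "mat n n (\<lambda>(i, j). M $$ (p i, q j)) $$ (i, j) = diag_block_mat [D1, D2] $$ (i, j)"
      using ij card(3) by (simp add: D1_def D2_def Let_def)
  qed (use card(3) in \<open>simp_all add: D1_def D2_def Let_def\<close>)
  moreover have "square_mat D1" "0 < dim_row D1" "square_mat D2" "0 < dim_row D2"
    using card by (simp_all add: D1_def D2_def)
  moreover have "dim_row M = n" "dim_col M = n" "square_mat M"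
    using M by auto
  ultimately show ?thesis
    unfolding decomposable_mat_def using p(1) q(1) by metis
qed

text \<open>A form suited to refuting decomposability: each nonzero entry ties its row to its
  column, so \<open>S\<close> consists of the rows of whole connected components of the bipartite
  graph of nonzero entries.\<close>

lemma decomposable_matE:
  assumes "decomposable_mat M" and M: "M \<in> carrier_mat n n"
  obtains S T where "S \<subset> {..<n}" "S \<noteq> {}"
    "\<And>i j. i < n \<Longrightarrow> j < n \<Longrightarrow> M $$ (i, j) \<noteq> 0 \<Longrightarrow> i \<in> S \<longleftrightarrow> j \<in> T"
proof -
  obtain p q D1 D2 where p: "p permutes {..<n}" and q: "q permutes {..<n}"
    and D1: "square_mat D1" "0 < dim_row D1" and D2: "square_mat D2" "0 < dim_row D2"
    and eq: "mat n n (\<lambda>(i, j). M $$ (p i, q j)) = diag_block_mat [D1, D2]"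
    using assms unfolding decomposable_mat_def by auto
  let ?k = "dim_row D1"
  have n: "n = ?k + dim_row D2"
    using arg_cong[OF eq, of dim_row] by (simp add: Let_def)
  have zero: "M $$ (p i, q j) = 0" if "i < n" "j < n" "(i < ?k) \<noteq> (j < ?k)" for i j
  proof -
    have "M $$ (p i, q j) = diag_block_mat [D1, D2] $$ (i, j)"
      using that unfolding eq[symmetric] by simp
    then show ?thesis
      using that n D1 D2 by (auto simp: Let_def)
  qed
  have inj: "inj p" "inj q"
    using p q by (auto intro: permutes_inj)
  show thesis
  proof (rule that[of "p ` {..<?k}" "q ` {..<?k}"])
    have "p ` {..<?k} \<subseteq> p ` {..<n}" "p ` {..<n} = {..<n}"
      using n permutes_image[OF p] by auto
    moreover have "p ?k \<in> {..<n}" "p ?k \<notin> p ` {..<?k}"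
      using n D2 permutes_in_image[OF p, of ?k] inj by (auto simp: inj_eq)
    ultimately show "p ` {..<?k} \<subset> {..<n}" by blast
    show "p ` {..<?k} \<noteq> {}" using D1 by auto
    fix i j assume ij: "i < n" "j < n" "M $$ (i, j) \<noteq> 0"
    obtain i' j' where "i = p i'" "i' < n" "j = q j'" "j' < n"
      using ij(1,2) permutes_image[OF p] permutes_image[OF q] by (metis imageE lessThan_iff)
    then show "i \<in> p ` {..<?k} \<longleftrightarrow> j \<in> q ` {..<?k}"
      using zero[of i' j'] ij(3) inj by (auto simp: inj_image_mem_iff)
  qed
qed

section \<open>Half-integral matrices of order 8\<close>

text \<open>Storing doubled entries as integers makes identities between matrices of level at most 2
  checkable by evaluation.\<close>

definition half_mat :: "int list list \<Rightarrow> rat mat" where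
  "half_mat M = mat 8 8 (\<lambda>(i, j). of_int (M ! i ! j) / 2)"

lemma half_mat_carrier [simp]: "half_mat M \<in> carrier_mat 8 8"
  and dim_half_mat [simp]: "dim_row (half_mat M) = 8" "dim_col (half_mat M) = 8"
  and index_half_mat [simp]:
    "i < 8 \<Longrightarrow> j < 8 \<Longrightarrow> half_mat M $$ (i, j) = of_int (M ! i ! j) / 2"
  by (simp_all add: half_mat_def)

text \<open>Because the entries are doubled, row sums 1 become 2 and inner products 1 become
  4.\<close>

definition orthogonal_entries :: "int list list \<Rightarrow> bool" where
  "orthogonal_entries M \<longleftrightarrow> (\<forall>i\<in>set [0..<8]. (\<Sum>k\<leftarrow>[0..<8]. M ! i ! k) = 2 \<and>
     (\<forall>j\<in>set [0..<8]. (\<Sum>k\<leftarrow>[0..<8]. M ! k ! i * M ! k ! j) = (if i = j then 4 else 0) \<and>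
       (\<Sum>k\<leftarrow>[0..<8]. M ! i ! k * M ! j ! k) = (if i = j then 4 else 0)))"

lemma sum_upt8: "(\<Sum>k\<leftarrow>[0..<8]. f k) = (\<Sum>k<8. f k)"
  by (simp add: interv_sum_list_conv_sum_set_nat atLeast0LessThan)

lemma half_mat_times:
  assumes "i < 8" "j < 8"
  shows "(half_mat M * half_mat N) $$ (i, j) = of_int (\<Sum>k<8. M ! i ! k * N ! k ! j) / 4"
    "(transpose_mat (half_mat M) * half_mat N) $$ (i, j) = of_int (\<Sum>k<8. M ! k ! i * N ! k ! j) / 4"
    "(half_mat M * transpose_mat (half_mat N)) $$ (i, j) = of_int (\<Sum>k<8. M ! i ! k * N ! j ! k) / 4"
  using assms by (simp_all add: scalar_prod_def atLeast0LessThan sum_divide_distrib)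

lemma regular_orthogonal_half_mat:
  assumes "orthogonal_entries M"
  shows "regular_orthogonal_mat (half_mat M)"
proof -
  have cols: "(\<Sum>k<8. M ! k ! i * M ! k ! j) = (if i = j then 4 else 0)"
    and rows: "(\<Sum>k<8. M ! i ! k * M ! j ! k) = (if i = j then 4 else 0)"
    and sums: "(\<Sum>k<8. M ! i ! k) = 2" if "i < 8" "j < 8" for i j
    using assms that unfolding orthogonal_entries_def sum_upt8 set_upt by (meson atLeastLessThan_iff zero_le)+
  have "transpose_mat (half_mat M) * half_mat M = 1\<^sub>m 8"
  proof (rule eq_matI)
    fix i j assume "i < dim_row (1\<^sub>m 8)" "j < dim_col (1\<^sub>m 8)"
    then have ij: "i < 8" "j < 8" by simp_all
    then show "(transpose_mat (half_mat M) * half_mat M) $$ (i, j) = 1\<^sub>m 8 $$ (i, j)"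
      unfolding half_mat_times(2)[OF ij] cols[OF ij] by simp
  qed simp_all
  moreover have "half_mat M * transpose_mat (half_mat M) = 1\<^sub>m 8"
  proof (rule eq_matI)
    fix i j assume "i < dim_row (1\<^sub>m 8)" "j < dim_col (1\<^sub>m 8)"
    then have ij: "i < 8" "j < 8" by simp_all
    then show "(half_mat M * transpose_mat (half_mat M)) $$ (i, j) = 1\<^sub>m 8 $$ (i, j)"
      unfolding half_mat_times(3)[OF ij] rows[OF ij] by simp
  qed simp_all
  moreover have "(\<Sum>j<8. half_mat M $$ (i, j)) = 1" if "i < 8" for i
  proof -
    have "(\<Sum>j<8. half_mat M $$ (i, j)) = of_int (\<Sum>j<8. M ! i ! j) / 2"
      using that by (simp add: sum_divide_distrib)
    then show ?thesis unfolding sums[OF that that] by simp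
  qed
  ultimately show ?thesis
    unfolding regular_orthogonal_mat_def dim_half_mat square_mat.simps by blast
qed

lemma level_half_mat: "level (half_mat M) \<le> 2"
proof -
  have "of_nat 2 * half_mat M $$ (i, j) \<in> \<int>" if "i < 8" "j < 8" for i j
    using that by simp
  then show ?thesis
    unfolding level_def dim_half_mat by (intro Least_le conjI allI impI) simp_all
qed

definition splits :: "int list list \<Rightarrow> nat list \<Rightarrow> nat list \<Rightarrow> bool" where
  "splits M S T \<longleftrightarrow> distinct S \<and> distinct T \<and> length S = length T \<and> S \<noteq> [] \<and> length S < 8 \<and>
     (\<forall>i\<in>set (S @ T). i < 8) \<and>
     (\<forall>i\<in>set [0..<8]. \<forall>j\<in>set [0..<8]. (i \<in> set S) \<noteq> (j \<in> set T) \<longrightarrow> M ! i ! j = 0)"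

lemma decomposable_half_mat:
  assumes "splits M S T"
  shows "decomposable_mat (half_mat M)"
proof (rule decomposable_matI[of _ 8 "set S" "set T"])
  show "half_mat M $$ (i, j) = 0" if "i < 8" "j < 8" "(i \<in> set S) \<noteq> (j \<in> set T)" for i j
  proof -
    have "M ! i ! j = 0"
      using assms that unfolding splits_def set_upt by (meson atLeastLessThan_iff zero_le)
    then show ?thesis using that by simp
  qed
  show "set S \<subseteq> {..<8}" "set T \<subseteq> {..<8}"
    using assms unfolding splits_def set_append by blast+
  show "card (set S) = card (set T)" "0 < card (set S)" "card (set S) < 8"
    using assms unfolding splits_def by (metis distinct_card length_greater_0_conv)+
qed simp

section \<open>The matrix of the cube\<close>

definition cube :: "int list list" where
  "cube =
    [[-1,  0,  1,  0,  1,  0,  1,  0],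
     [ 0, -1,  0,  1,  0,  1,  0,  1],
     [ 1,  0,  0, -1,  1,  0,  0,  1],
     [ 0,  1, -1,  0,  0,  1,  1,  0],
     [ 1,  0,  0,  1,  0, -1,  1,  0],
     [ 0,  1,  1,  0, -1,  0,  0,  1],
     [ 1,  0,  1,  0,  0,  1,  0, -1],
     [ 0,  1,  0,  1,  1,  0, -1,  0]]"

lemma less_8_cases: "i < (8::nat) \<longleftrightarrow> i \<in> {0, 1, 2, 3, 4, 5, 6, 7}"
  by auto

lemma R_cube_eq: "R_cube = half_mat cube"
  by (rule eq_matI)
    (auto simp: R_cube_def half_mat_def cube_def Let_def less_8_cases)

lemma orthogonal_entries_cube: "orthogonal_entries cube"
  by code_simp

lemma regular_orthogonal_R_cube: "regular_orthogonal_mat R_cube"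
  unfolding R_cube_eq by (rule regular_orthogonal_half_mat[OF orthogonal_entries_cube])

lemma level_R_cube: "level R_cube = 2"
proof -
  let ?P = "\<lambda>l. 0 < l \<and> (\<forall>i<8. \<forall>j<8. of_nat l * half_mat cube $$ (i, j) \<in> \<int>)"
  have level: "level R_cube = (LEAST l. ?P l)"
    by (simp add: level_def R_cube_eq)
  have "?P 2" by simp
  then have P: "?P (level R_cube)"
    unfolding level by (rule LeastI)
  have "half_mat cube $$ (0, 2) = 1 / 2"
    by (simp add: cube_def)
  moreover have "(1 / 2 :: rat) \<notin> \<int>"
  proof
    assume "(1 / 2 :: rat) \<in> \<int>"
    then obtain z where "(1 / 2 :: rat) = of_int z" by (auto elim: Ints_cases)
    then have "(of_int (2 * z) :: rat) = of_int 1" by simp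
    then have "2 * z = 1" by (rule of_int_eq_iff[THEN iffD1])
    then show False by presburger
  qed
  ultimately have "level R_cube \<noteq> 1"
    using P[THEN conjunct2, rule_format, of 0 2] by auto
  then show ?thesis
    using P level_half_mat[of cube] by (simp add: R_cube_eq)
qed

lemma indecomposable_R_cube: "\<not> decomposable_mat R_cube"
proof
  assume "decomposable_mat R_cube"
  then obtain S T where S: "S \<subset> {..<8}" "S \<noteq> {}"
    and conn: "\<And>i j. i < 8 \<Longrightarrow> j < 8 \<Longrightarrow> cube ! i ! j \<noteq> 0 \<Longrightarrow> i \<in> S \<longleftrightarrow> j \<in> T"
    unfolding R_cube_eq by (rule decomposable_matE[of _ 8]) auto
  \<comment> \<open>Column 0 joins the rows 0, 2, 4, 6, column 1 joins the rows 1, 3, 5, 7, and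
    column 2 joins rows 0 and 3, so all rows lie in one component.\<close>
  have "i \<in> S \<longleftrightarrow> 0 \<in> S" if "i < 8" for i
    using that
      conn[of 0 0] conn[of 2 0] conn[of 4 0] conn[of 6 0] conn[of 0 2] conn[of 3 2]
      conn[of 1 1] conn[of 3 1] conn[of 5 1] conn[of 7 1]
    by (auto simp: less_8_cases cube_def)
  then show False
    using S by auto
qed

section \<open>Switching conditions\<close>

text \<open>A graph on four vertices is regular exactly if it is a union of some of the three
  perfect matchings, that is, if opposite edges agree.\<close>

fun regular_on :: "(nat \<Rightarrow> nat \<Rightarrow> bool) \<Rightarrow> nat list \<Rightarrow> bool" where
  "regular_on x [a, b, c, d] \<longleftrightarrow> (x a b = x c d) \<and> (x a c = x b d) \<and> (x a d = x b c)"
| "regular_on x _ \<longleftrightarrow> False"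

text \<open>Nested Boolean equivalences express parity: \<open>i\<close> has 0, 2 or 4 neighbours in
  the set.\<close>

fun even_to :: "(nat \<Rightarrow> nat \<Rightarrow> bool) \<Rightarrow> nat list \<Rightarrow> nat \<Rightarrow> bool" where
  "even_to x [a, b, c, d] i \<longleftrightarrow> ((x a i = x b i) = (x c i = x d i))"
| "even_to x _ i \<longleftrightarrow> False"

text \<open>
  For \<open>K = J / 2 - I\<close> of order 4, \<open>cross X\<close> states that \<open>K X K\<close> is a 01-matrix; its entries are scaled
  by 4 here.
\<close>

definition cross :: "bool list list \<Rightarrow> bool" where
  "cross X \<longleftrightarrow>
     (let r = map (\<lambda>i. \<Sum>j\<leftarrow>[0..<4]. of_bool (X ! i ! j)) [0..<4];
          c = map (\<lambda>j. \<Sum>i\<leftarrow>[0..<4]. of_bool (X ! i ! j)) [0..<4];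
          s = sum_list r
      in list_all (\<lambda>i. list_all (\<lambda>j.
           4 * of_bool (X ! i ! j) + s - 2 * (r ! i + c ! j) \<in> {0, 4 :: int}) [0..<4]) [0..<4])"

text \<open>The Godsil-McKay condition for a switching set of size 4, with \<open>C\<close> the set
  of outside vertices.\<close>

definition single_switch :: "(nat \<Rightarrow> nat \<Rightarrow> bool) \<Rightarrow> nat list \<Rightarrow> nat list \<Rightarrow> bool" where
  "single_switch x A C \<longleftrightarrow> regular_on x A \<and> list_all (even_to x A) C"

definition double_switch :: "(nat \<Rightarrow> nat \<Rightarrow> bool) \<Rightarrow> nat list \<Rightarrow> nat list \<Rightarrow> bool" where
  "double_switch x A C \<longleftrightarrow> regular_on x A \<and> regular_on x C \<and> cross (map (\<lambda>a. map (x a) C) A)"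

text \<open>Words of weight 4 in the extended Hamming code are the planes of the affine space of
  dimension 3 over the field with two elements; each pair here consists of parallel planes.\<close>

definition planes :: "(nat list \<times> nat list) list" where
  "planes =
    [([0, 2, 4, 6], [1, 3, 5, 7]), ([0, 2, 5, 7], [1, 3, 4, 6]),
     ([0, 3, 4, 7], [1, 2, 5, 6]), ([0, 3, 5, 6], [1, 2, 4, 7])]"

definition switchable :: "(nat \<Rightarrow> nat \<Rightarrow> bool) \<Rightarrow> bool" where
  "switchable x \<longleftrightarrow>
     list_ex (\<lambda>(A, C). single_switch x A C \<or> single_switch x C A \<or> double_switch x A C) planes"

text \<open>
  The order of the edges is the order of the decisions in the search. It was chosen to make the
  search fail early.
\<close>

definition edges :: "(nat \<times> nat) list" where
  "edges =
    [(1, 7), (1, 3), (5, 7), (1, 5), (3, 7), (3, 5), (1, 2), (1, 4), (2, 7), (4, 7),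
     (2, 4), (3, 4), (2, 3), (4, 5), (2, 5), (1, 6), (2, 6), (4, 6), (5, 6), (3, 6), (6, 7),
     (0, 2), (0, 1), (0, 7), (0, 5), (0, 6), (0, 3), (0, 4)]"

text \<open>The search conses each decision onto its list, so at a leaf the values stand in the
  reverse order of \<open>edges\<close>.\<close>

definition switchable_list :: "bool list \<Rightarrow> bool" where
  "switchable_list xs = switchable (\<lambda>a b. the (map_of (zip (rev edges) xs) (min a b, max a b)))"

text \<open>
  This unfolded form is evaluated at each leaf of the search.
\<close>

lemma switchable_list_code [code]:
  "switchable_list
     [x04, x03, x06, x05, x07, x01, x02, x67, x36, x56, x46, x26, x16, x25, x45, x23,
      x34, x24, x47, x27, x14, x12, x35, x37, x15, x57, x13, x17] \<longleftrightarrow>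
    ((x02 = x46) \<and> (x04 = x26) \<and> (x06 = x24) \<and>
      ((x01 = x12) = (x14 = x16)) \<and> ((x03 = x23) = (x34 = x36)) \<and>
      ((x05 = x25) = (x45 = x56)) \<and> ((x07 = x27) = (x47 = x67)))
    \<or> ((x13 = x57) \<and> (x15 = x37) \<and> (x17 = x35) \<and>
      ((x01 = x03) = (x05 = x07)) \<and> ((x12 = x23) = (x25 = x27)) \<and>
      ((x14 = x34) = (x45 = x47)) \<and> ((x16 = x36) = (x56 = x67)))
    \<or> ((x02 = x46) \<and> (x04 = x26) \<and> (x06 = x24) \<and> (x13 = x57) \<and> (x15 = x37) \<and> (x17 = x35) \<and>
      cross [[x01, x03, x05, x07], [x12, x23, x25, x27], [x14, x34, x45, x47], [x16, x36, x56, x67]])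
    \<or> ((x02 = x57) \<and> (x05 = x27) \<and> (x07 = x25) \<and>
      ((x01 = x12) = (x15 = x17)) \<and> ((x03 = x23) = (x35 = x37)) \<and>
      ((x04 = x24) = (x45 = x47)) \<and> ((x06 = x26) = (x56 = x67)))
    \<or> ((x13 = x46) \<and> (x14 = x36) \<and> (x16 = x34) \<and>
      ((x01 = x03) = (x04 = x06)) \<and> ((x12 = x23) = (x24 = x26)) \<and>
      ((x15 = x35) = (x45 = x56)) \<and> ((x17 = x37) = (x47 = x67)))
    \<or> ((x02 = x57) \<and> (x05 = x27) \<and> (x07 = x25) \<and> (x13 = x46) \<and> (x14 = x36) \<and> (x16 = x34) \<and>
      cross [[x01, x03, x04, x06], [x12, x23, x24, x26], [x15, x35, x45, x56], [x17, x37, x47, x67]])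
    \<or> ((x03 = x47) \<and> (x04 = x37) \<and> (x07 = x34) \<and>
      ((x01 = x13) = (x14 = x17)) \<and> ((x02 = x23) = (x24 = x27)) \<and>
      ((x05 = x35) = (x45 = x57)) \<and> ((x06 = x36) = (x46 = x67)))
    \<or> ((x12 = x56) \<and> (x15 = x26) \<and> (x16 = x25) \<and>
      ((x01 = x02) = (x05 = x06)) \<and> ((x13 = x23) = (x35 = x36)) \<and>
      ((x14 = x24) = (x45 = x46)) \<and> ((x17 = x27) = (x57 = x67)))
    \<or> ((x03 = x47) \<and> (x04 = x37) \<and> (x07 = x34) \<and> (x12 = x56) \<and> (x15 = x26) \<and> (x16 = x25) \<and>
      cross [[x01, x02, x05, x06], [x13, x23, x35, x36], [x14, x24, x45, x46], [x17, x27, x57, x67]])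
    \<or> ((x03 = x56) \<and> (x05 = x36) \<and> (x06 = x35) \<and>
      ((x01 = x13) = (x15 = x16)) \<and> ((x02 = x23) = (x25 = x26)) \<and>
      ((x04 = x34) = (x45 = x46)) \<and> ((x07 = x37) = (x57 = x67)))
    \<or> ((x12 = x47) \<and> (x14 = x27) \<and> (x17 = x24) \<and>
      ((x01 = x02) = (x04 = x07)) \<and> ((x13 = x23) = (x34 = x37)) \<and>
      ((x15 = x25) = (x45 = x57)) \<and> ((x16 = x26) = (x46 = x67)))
    \<or> ((x03 = x56) \<and> (x05 = x36) \<and> (x06 = x35) \<and> (x12 = x47) \<and> (x14 = x27) \<and> (x17 = x24) \<and>
      cross [[x01, x02, x04, x07], [x13, x23, x34, x37], [x15, x25, x45, x57], [x16, x26, x46, x67]])"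
  unfolding switchable_list_def switchable_def planes_def edges_def
  by (simp add: single_switch_def double_switch_def)

text \<open>Carries the verdict at a leaf back to \<open>x\<close>; the listed instances of symmetry
  put the smaller vertex of each pair first.\<close>

lemma switchable_list_edges:
  assumes "\<And>a b. x a b = x b a"
  shows "switchable_list (rev (map (\<lambda>(a, b). x a b) edges)) = switchable x"
proof -
  have "rev (map (\<lambda>(a, b). x a b) edges) =
     [x 0 4, x 0 3, x 0 6, x 0 5, x 0 7, x 0 1, x 0 2, x 6 7, x 3 6, x 5 6, x 4 6, x 2 6,
      x 1 6, x 2 5, x 4 5, x 2 3, x 3 4, x 2 4, x 4 7, x 2 7, x 1 4, x 1 2, x 3 5, x 3 7,
      x 1 5, x 5 7, x 1 3, x 1 7]"
    by (simp add: edges_def)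
  then show ?thesis
    unfolding switchable_def planes_def
    by (simp del: One_nat_def add: switchable_list_code single_switch_def double_switch_def
        assms[of 1 0] assms[of 2 0] assms[of 3 0] assms[of 4 0] assms[of 5 0] assms[of 6 0]
        assms[of 7 0] assms[of 2 1] assms[of 3 1] assms[of 4 1] assms[of 5 1] assms[of 6 1]
        assms[of 7 1] assms[of 3 2] assms[of 4 2] assms[of 5 2] assms[of 6 2] assms[of 7 2]
        assms[of 4 3] assms[of 5 3] assms[of 6 3] assms[of 7 3] assms[of 5 4] assms[of 6 4]
        assms[of 7 4] assms[of 6 5] assms[of 7 5] assms[of 7 6])
qed

section \<open>Backtracking search\<close>

text \<open>
  A condition \<open>\<Sum>e. w e * x e \<in> {0, 4}\<close> on 01-variables \<open>x e\<close> is turned into a cardinality condition by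
  taking \<open>\<bar>w e\<bar>\<close> copies of the literal \<open>x e\<close> or, for negative \<open>w e\<close>, of its negation: the number of true
  literals minus the number of negated ones is the value of the sum.
  \<open>Exactly t f\<close> demands that, among the literals still to be read, exactly \<open>t\<close> are true and \<open>f\<close> are
  false; \<open>Four_more t f\<close> demands \<open>t\<close> true and \<open>f + 4\<close> false ones or \<open>t + 4\<close> true and \<open>f\<close> false ones.
\<close>

datatype counter = Stuck | Exactly nat nat | Four_more nat nat

text \<open>In \<open>Four_more 0 f\<close> a true literal rules out the alternative with no true
  ones, which leaves 3 true and \<open>f\<close> false; \<open>Four_more t 0\<close> is
  dual.\<close>

fun count_step :: "bool \<Rightarrow> counter \<Rightarrow> counter" where
  "count_step b Stuck = Stuck"
| "count_step True (Exactly 0 f) = Stuck"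
| "count_step True (Exactly (Suc t) f) = Exactly t f"
| "count_step False (Exactly t 0) = Stuck"
| "count_step False (Exactly t (Suc f)) = Exactly t f"
| "count_step True (Four_more 0 f) = Exactly 3 f"
| "count_step True (Four_more (Suc t) f) = Four_more t f"
| "count_step False (Four_more t 0) = Exactly t 3"
| "count_step False (Four_more t (Suc f)) = Four_more t f"

primrec read_literals :: "bool \<Rightarrow> bool list \<Rightarrow> counter \<Rightarrow> counter" where
  "read_literals y [] s = s"
| "read_literals y (l # ls) s = read_literals y ls (count_step (l = y) s)"

text \<open>
  In a constraint \<open>(s, lss)\<close>, the list \<open>lss\<close> holds for each variable still to be assigned the
  multiset of its literals. The function \<open>advance\<close> assigns the next variable in all constraints.
  It is written without local bindings of constraints, which would slow down the simplifier.
\<close>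

type_synonym constr = "counter \<times> bool list list"

fun advance ::
  "bool \<Rightarrow> counter \<Rightarrow> bool list list \<Rightarrow> constr list \<Rightarrow> constr list \<Rightarrow> constr list option" where
  "advance y Stuck lss cs ds = None"
| "advance y s lss [] ds = Some ((s, lss) # ds)"
| "advance y s lss ((s', ls # lss') # cs) ds =
     advance y (read_literals y ls s') lss' cs ((s, lss) # ds)"
| "advance y s lss ((s', []) # cs) ds = None"

text \<open>The number counts the undecided edges. A branch that \<open>advance\<close> refutes
  holds vacuously, and a branch surviving to a leaf must be switchable there. Malformed constraint
  lists give \<open>False\<close>, so a positive answer can be trusted.\<close>

fun search :: "nat \<Rightarrow> bool list \<Rightarrow> constr list \<Rightarrow> bool" where
  "search 0 xs cs = switchable_list xs"
| "search (Suc n) xs [] = False"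
| "search (Suc n) xs ((s, []) # cs) = False"
| "search (Suc n) xs ((s, ls # lss) # cs) =
     ((case advance True (read_literals True ls s) lss cs [] of
         None \<Rightarrow> True | Some ds \<Rightarrow> search n (True # xs) ds) \<and>
      (case advance False (read_literals False ls s) lss cs [] of
         None \<Rightarrow> True | Some ds \<Rightarrow> search n (False # xs) ds))"

section \<open>Soundness of the search\<close>

lemma read_literals_eq_fold: "read_literals y ls s = fold count_step (map (\<lambda>l. l = y) ls) s"
  by (induction ls arbitrary: s) simp_all

lemma fold_count_step_Stuck: "fold count_step bs Stuck = Stuck"
  by (induction bs) simp_all

lemma fold_count_step_Exactly:
  "count_list bs True = t \<Longrightarrow> count_list bs False = f \<Longrightarrow> fold count_step bs (Exactly t f) \<noteq> Stuck"
proof (induction bs arbitrary: t f)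
  case (Cons b bs)
  then show ?case
    by (cases b; cases t; cases f) auto
qed simp

text \<open>While both supplies last, the two alternatives stay open; the first literal beyond one
  supply decides between them and reduces to the case \<open>Exactly\<close>.\<close>

lemma fold_count_step_Four_more:
  "count_list bs True = t \<and> count_list bs False = f + 4 \<or>
   count_list bs True = t + 4 \<and> count_list bs False = f \<Longrightarrow>
   fold count_step bs (Four_more t f) \<noteq> Stuck"
proof (induction bs arbitrary: t f)
  case (Cons b bs)
  have *: "fold count_step bs (Exactly t' f') \<noteq> Stuck"
    if "count_list bs True = t'" "count_list bs False = f'" for t' f'
    using fold_count_step_Exactly[OF that] .
  show ?case
  proof (cases b)
    case True
    then show ?thesis
      using Cons.prems Cons.IH by (cases t) (auto simp: *)
  next
    case False
    then show ?thesis
      using Cons.prems Cons.IH by (cases f) (auto simp: *)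
  qed
qed simp

definition literal_values :: "bool list list \<Rightarrow> bool list \<Rightarrow> bool list" where
  "literal_values lss ys = concat (map2 (\<lambda>ls y. map (\<lambda>l. l = y) ls) lss ys)"

text \<open>The invariant of the search: \<open>ys\<close> assigns the undecided edges, and reading
  all their literals does not get stuck.\<close>

definition satisfied :: "bool list \<Rightarrow> constr \<Rightarrow> bool" where
  "satisfied ys = (\<lambda>(s, lss). length lss = length ys \<and> fold count_step (literal_values lss ys) s \<noteq> Stuck)"

lemma satisfied_not_Stuck: "satisfied ys (s, lss) \<Longrightarrow> s \<noteq> Stuck"
  by (auto simp: satisfied_def fold_count_step_Stuck)

lemma satisfied_Cons:
  assumes "satisfied (y # ys) (s, lss)"
  obtains ls lss' where "lss = ls # lss'" "satisfied ys (read_literals y ls s, lss')"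
  using assms by (cases lss) (auto simp: satisfied_def literal_values_def read_literals_eq_fold)

text \<open>As \<open>Stuck\<close> is absorbing, a counter that survives the whole assignment is
  not stuck after one step, so the branch of a satisfying assignment is never refuted.\<close>

lemma advance_satisfied:
  assumes "list_all (satisfied (y # ys)) cs" "satisfied ys (s, lss)" "list_all (satisfied ys) ds"
  shows "\<exists>es. advance y s lss cs ds = Some es \<and> list_all (satisfied ys) es"
  using assms
proof (induction cs arbitrary: s lss ds)
  case Nil
  then show ?case
    using satisfied_not_Stuck[of ys s lss] by (cases s) auto
next
  case (Cons c cs)
  obtain s' lss'' where c: "c = (s', lss'')" by (cases c)
  obtain ls lss' where "lss'' = ls # lss'" "satisfied ys (read_literals y ls s', lss')"
    using Cons.prems(1) by (auto simp: c elim: satisfied_Cons)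
  then show ?case
    using Cons.IH[of "read_literals y ls s'" lss' "(s, lss) # ds"] Cons.prems
      satisfied_not_Stuck[of ys s lss]
    by (cases s) (auto simp: c)
qed

text \<open>Following the decisions \<open>ys\<close> down the tree, no step is refuted, so the leaf
  of \<open>ys\<close> is reached and was found switchable.\<close>

lemma search_sound:
  assumes "search (length ys) xs cs" "list_all (satisfied ys) cs"
  shows "switchable_list (rev ys @ xs)"
  using assms
proof (induction ys arbitrary: xs cs)
  case (Cons y ys)
  then obtain c cs' where cs: "cs = c # cs'"
    by (cases cs) auto
  obtain s lss where c: "c = (s, lss)" by (cases c)
  obtain ls lss' where lss: "lss = ls # lss'" "satisfied ys (read_literals y ls s, lss')"
    using Cons.prems(2) by (auto simp: c cs elim: satisfied_Cons)
  obtain es where "advance y (read_literals y ls s) lss' cs' [] = Some es" "list_all (satisfied ys) es"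
    using advance_satisfied[of y ys cs' "read_literals y ls s" lss' "[]"] lss(2) Cons.prems(2)
    by (auto simp: cs)
  then show ?case
    using Cons.IH[of "y # xs" es] Cons.prems(1) by (cases y) (auto simp: cs c lss)
qed simp

text \<open>
  With \<open>x\<close> the adjacency relation of \<open>B\<close>, the entry \<open>(i, j)\<close> of \<open>half_mat M\<^sup>T B half_mat M\<close> is a
  quarter of \<open>edge_sum M x i j\<close> if \<open>i \<noteq> j\<close>, and half of it if \<open>i = j\<close>.
\<close>

definition weight :: "int list list \<Rightarrow> nat \<Rightarrow> nat \<Rightarrow> nat \<times> nat \<Rightarrow> int" where
  "weight M i j = (\<lambda>(a, b).
     if i = j then M ! a ! i * M ! b ! i else M ! a ! i * M ! b ! j + M ! b ! i * M ! a ! j)"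

definition edge_sum :: "int list list \<Rightarrow> (nat \<Rightarrow> nat \<Rightarrow> bool) \<Rightarrow> nat \<Rightarrow> nat \<Rightarrow> int" where
  "edge_sum M x i j = (\<Sum>(a, b)\<leftarrow>edges. weight M i j (a, b) * of_bool (x a b))"

definition admissible :: "int list list \<Rightarrow> (nat \<Rightarrow> nat \<Rightarrow> bool) \<Rightarrow> nat \<Rightarrow> nat \<Rightarrow> bool" where
  "admissible M x i j \<longleftrightarrow> edge_sum M x i j \<in> (if i = j then {0} else {0, 4})"

definition literals :: "int \<Rightarrow> bool list" where
  "literals w = replicate (nat \<bar>w\<bar>) (0 < w)"

text \<open>Here \<open>t\<close> counts the negated and \<open>f\<close> the positive literals. If
  the sum has value v, then t + v literals are true and f - v are false; the value 4 is therefore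
  impossible when \<open>f < 4\<close>.\<close>

definition constr_of :: "int list list \<Rightarrow> nat \<times> nat \<Rightarrow> constr" where
  "constr_of M = (\<lambda>(i, j).
     let lss = map (\<lambda>e. literals (weight M i j e)) edges;
         t = count_list (concat lss) False;
         f = count_list (concat lss) True
     in (if i = j \<or> f < 4 then Exactly t f else Four_more t (f - 4), lss))"

lemma count_list_replicate: "count_list (replicate n a) b = (if a = b then n else 0)"
  by (induction n) auto

lemma literal_values_counts:
  fixes w :: "'a \<Rightarrow> int" and y :: "'a \<Rightarrow> bool" and es :: "'a list"
  defines "bs \<equiv> literal_values (map (\<lambda>e. literals (w e)) es) (map y es)"
    and "ls \<equiv> concat (map (\<lambda>e. literals (w e)) es)"
  shows "int (count_list bs True) = (\<Sum>e\<leftarrow>es. w e * of_bool (y e)) + int (count_list ls False)"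
    and "int (count_list bs False) = int (count_list ls True) - (\<Sum>e\<leftarrow>es. w e * of_bool (y e))"
  unfolding bs_def ls_def
  by (induction es)
    (auto simp: literal_values_def literals_def count_list_append count_list_replicate map_replicate)

lemma satisfied_constr_of:
  assumes "admissible M x i j"
  shows "satisfied (map (\<lambda>(a, b). x a b) edges) (constr_of M (i, j))"
proof -
  let ?y = "\<lambda>(a, b). x a b"
  let ?lss = "map (\<lambda>e. literals (weight M i j e)) edges"
  let ?bs = "literal_values ?lss (map ?y edges)"
  let ?t = "count_list (concat ?lss) False" and ?f = "count_list (concat ?lss) True"
  have "edge_sum M x i j = (\<Sum>e\<leftarrow>edges. weight M i j e * of_bool (?y e))"
    unfolding edge_sum_def by (rule arg_cong[of _ _ sum_list], rule map_cong) auto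
  then have counts: "int (count_list ?bs True) = edge_sum M x i j + int ?t"
    "int (count_list ?bs False) = int ?f - edge_sum M x i j"
    using literal_values_counts[of "weight M i j" edges ?y] by simp_all
  have sum: "edge_sum M x i j = 0 \<or> i \<noteq> j \<and> edge_sum M x i j = 4"
    using assms by (auto simp: admissible_def split: if_splits)
  show ?thesis
  proof (cases "i = j \<or> ?f < 4")
    case True
    then have "edge_sum M x i j = 0"
      using sum counts(2) by linarith
    then have "fold count_step ?bs (Exactly ?t ?f) \<noteq> Stuck"
      using counts by (intro fold_count_step_Exactly) linarith+
    then show ?thesis
      using True by (simp add: satisfied_def constr_of_def Let_def)
  next
    case False
    have "fold count_step ?bs (Four_more ?t (?f - 4)) \<noteq> Stuck"
      by (intro fold_count_step_Four_more) (use counts sum False in linarith)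
    then show ?thesis
      using False by (simp add: satisfied_def constr_of_def Let_def)
  qed
qed

text \<open>
  Ten of the 36 conditions on \<open>B\<close> already suffice.
\<close>

lemma search_cube:
  "search 28 [] (map (constr_of cube)
     [(3, 6), (3, 5), (4, 7), (1, 6), (5, 5), (1, 3), (7, 7), (4, 4), (3, 3), (1, 1)])"
  by code_simp

lemma switchable_if_admissible:
  assumes sym: "\<And>a b. x a b = x b a" and "\<And>i j. i < 8 \<Longrightarrow> j < 8 \<Longrightarrow> admissible cube x i j"
  shows "switchable x"
proof -
  let ?ys = "map (\<lambda>(a, b). x a b) edges"
  have "length ?ys = 28"
    by (simp add: edges_def)
  then have "switchable_list (rev ?ys @ [])"
    using assms(2) by (intro search_sound[OF search_cube[folded \<open>length ?ys = 28\<close>]])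
      (simp add: satisfied_constr_of)
  then show ?thesis
    using switchable_list_edges[OF sym] by simp
qed

section \<open>Congruence by switching matrices\<close>

definition switch_mat :: "nat list list \<Rightarrow> int list list" where
  "switch_mat As = map (\<lambda>i. map (\<lambda>j.
     if list_ex (\<lambda>A. i \<in> set A \<and> j \<in> set A) As then (if i = j then -1 else 1)
     else if i = j then 2 else 0) [0..<8]) [0..<8]"

text \<open>Four times an entry of the congruence of \<open>B\<close> by \<open>half_mat M\<close>.
  The nesting allows the column sums of \<open>M\<close> to be evaluated one after the
  other.\<close>

definition quad :: "int list list \<Rightarrow> (nat \<Rightarrow> nat \<Rightarrow> bool) \<Rightarrow> nat \<Rightarrow> nat \<Rightarrow> int" where
  "quad M x i j = (\<Sum>p<8. M ! p ! i * (\<Sum>q<8. M ! q ! j * of_bool (x p q)))"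

text \<open>The index square splits into the diagonal, where \<open>x\<close> vanishes, the edges
  and the reversed edges. Both orientations of an edge together give its weight, and twice its
  weight if \<open>i = j\<close>.\<close>

lemma quad_eq_edge_sum:
  assumes sym: "\<And>a b. x a b = x b a" and irrefl: "\<And>a. \<not> x a a"
  shows "quad M x i j = (if i = j then 2 * edge_sum M x i j else edge_sum M x i j)"
proof -
  let ?F = "\<lambda>(p, q). M ! p ! i * M ! q ! j * of_bool (x p q)"
  let ?E = "set edges" and ?D = "(\<lambda>p. (p, p)) ` {..<8::nat}"
  have "?E = set [(a, b). b \<leftarrow> [0..<8], a \<leftarrow> [0..<b]]" and dist: "distinct edges"
    by code_simp+
  then have E: "?E = {(a, b). a < b \<and> b < 8}"
    by auto
  have "{..<8} \<times> {..<8} = ?D \<union> (?E \<union> prod.swap ` ?E)"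
  proof (intro equalityI subsetI)
    fix e :: "nat \<times> nat"
    assume "e \<in> {..<8} \<times> {..<8}"
    then show "e \<in> ?D \<union> (?E \<union> prod.swap ` ?E)"
      unfolding E by (cases e; cases "fst e" "snd e" rule: linorder_cases) force+
  qed (auto simp: E)
  moreover have disj: "?D \<inter> (?E \<union> prod.swap ` ?E) = {}" "?E \<inter> prod.swap ` ?E = {}"
    by (auto simp: E)
  moreover have "quad M x i j = sum ?F ({..<8} \<times> {..<8})"
    by (simp only: quad_def sum.cartesian_product[symmetric] sum_distrib_left mult.assoc)
  ultimately have "quad M x i j = sum ?F (?D \<union> (?E \<union> prod.swap ` ?E))"
    by (simp only:)
  also have "\<dots> = sum ?F ?D + (sum ?F ?E + sum ?F (prod.swap ` ?E))"
    using disj by (subst sum.union_disjoint; (subst sum.union_disjoint)?) simp_all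
  also have "sum ?F ?D = 0"
    by (intro sum.neutral) (auto simp: irrefl)
  also have "sum ?F (prod.swap ` ?E) = (\<Sum>e\<in>?E. ?F (prod.swap e))"
    by (simp add: sum.reindex)
  also have "0 + (sum ?F ?E + (\<Sum>e\<in>?E. ?F (prod.swap e))) = (\<Sum>e\<in>?E. ?F e + ?F (prod.swap e))"
    by (simp only: sum.distrib add_0)
  also have "\<dots> = (\<Sum>(a, b)\<in>?E. (if i = j then 2 else 1) * (weight M i j (a, b) * of_bool (x a b)))"
    using sym by (intro sum.cong) (auto simp: weight_def algebra_simps)
  also have "\<dots> = (if i = j then 2 else 1) * edge_sum M x i j"
    unfolding edge_sum_def sum_list_distinct_conv_sum_set[OF dist] sum_distrib_left
    by (intro sum.cong) auto
  finally show ?thesis by simp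
qed

lemma quad_commute:
  assumes "\<And>a b. x a b = x b a"
  shows "quad M x i j = quad M x j i"
proof -
  have "quad M x i j = (\<Sum>p<8. \<Sum>q<8. M ! p ! i * M ! q ! j * of_bool (x p q))"
    by (simp only: quad_def sum_distrib_left mult.assoc)
  also have "\<dots> = (\<Sum>q<8. \<Sum>p<8. M ! p ! i * M ! q ! j * of_bool (x p q))"
    by (rule sum.swap)
  also have "\<dots> = quad M x j i"
    unfolding quad_def sum_distrib_left
    by (intro sum.cong refl) (subst assms, simp only: mult_ac)
  finally show ?thesis .
qed

text \<open>Column \<open>i\<close> of the doubled matrix is the indicator vector of the block
  \<open>K\<close> of \<open>i\<close>, minus twice the unit vector at \<open>i\<close>.\<close>

lemma sum_block:
  fixes g :: "nat \<Rightarrow> int"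
  assumes "i < 8" "distinct K" "set K \<subseteq> {..<8}" "i \<in> set K"
    and "\<And>p. list_ex (\<lambda>A. p \<in> set A \<and> i \<in> set A) As \<longleftrightarrow> p \<in> set K"
  shows "(\<Sum>p<8. switch_mat As ! p ! i * g p) = (\<Sum>p\<leftarrow>K. g p) - 2 * g i"
proof -
  have "(\<Sum>p<8. switch_mat As ! p ! i * g p) =
      (\<Sum>p<8. (if p \<in> set K then g p else 0) - (if p = i then 2 * g p else 0))"
    by (rule sum.cong) (use assms in \<open>auto simp: switch_mat_def\<close>)
  also have "\<dots> = (\<Sum>p\<in>set K. g p) - 2 * g i"
    using assms(1,3) by (simp add: sum_subtractf sum.inter_restrict[symmetric] Int_absorb1)
  finally show ?thesis
    using assms(2) by (simp add: sum_list_distinct_conv_sum_set)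
qed

lemma sum_no_block:
  fixes g :: "nat \<Rightarrow> int"
  assumes "i < 8" "\<not> list_ex (\<lambda>A. i \<in> set A) As"
  shows "(\<Sum>p<8. switch_mat As ! p ! i * g p) = 2 * g i"
proof -
  have "(\<Sum>p<8. switch_mat As ! p ! i * g p) = (\<Sum>p<8. if p = i then 2 * g p else 0)"
    by (rule sum.cong) (use assms in \<open>auto simp: switch_mat_def list_ex_iff\<close>)
  then show ?thesis
    using assms(1) by simp
qed

section \<open>Effect of switching on the entries\<close>

locale graph =
  fixes x :: "nat \<Rightarrow> nat \<Rightarrow> bool"
  assumes sym: "x a b = x b a" and irrefl: "\<not> x a a"
begin

abbreviation good :: "int list list \<Rightarrow> nat \<Rightarrow> nat \<Rightarrow> bool" where
  "good M i j \<equiv> quad M x i j \<in> (if i = j then {0} else {0, 4})"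

text \<open>The adjacency matrix of a regular graph commutes with \<open>J\<close>, hence with
  \<open>J / 2 - I\<close>; in order 4 the latter is an involution, so the congruence fixes the
  block.\<close>

lemma regular_block:
  assumes "regular_on x K" "i \<in> set K" "j \<in> set K"
  shows "(\<Sum>p\<leftarrow>K. (\<Sum>q\<leftarrow>K. of_bool (x p q)) - 2 * of_bool (x p j)) -
      2 * ((\<Sum>q\<leftarrow>K. of_bool (x i q)) - 2 * of_bool (x i j)) = (4 * of_bool (x i j) :: int)"
proof -
  obtain a b c d where K: "K = [a, b, c, d]"
    using assms(1) by (auto elim: regular_on.elims)
  have reg: "x c d = x a b" "x b d = x a c" "x b c = x a d"
    using assms(1) by (simp_all add: K)
  note sym = sym[of b a] sym[of c a] sym[of d a] sym[of c b] sym[of d b] sym[of d c]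
  have "i = a \<or> i = b \<or> i = c \<or> i = d" "j = a \<or> j = b \<or> j = c \<or> j = d"
    using assms(2,3) by (simp_all add: K)
  then show ?thesis
    unfolding K by (elim disjE) (simp_all add: irrefl sym reg)
qed

lemma good_single_switch:
  assumes A: "single_switch x A C" "distinct A" "set A \<subseteq> {..<8}" "set C = {..<8} - set A"
    and ij: "i < 8" "j < 8"
  shows "good (switch_mat [A]) i j"
proof -
  let ?M = "switch_mat [A]"
  have ev: "even_to x A k" if "k \<in> {..<8} - set A" for k
    using A(1) that unfolding A(4)[symmetric] single_switch_def list_all_iff by auto
  have reg: "regular_on x A"
    using A(1) by (simp add: single_switch_def)
  have block: "(\<Sum>p<8. ?M ! p ! k * g p) = (\<Sum>p\<leftarrow>A. g p) - 2 * g k"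
    if "k \<in> set A" for k and g :: "nat \<Rightarrow> int"
    by (rule sum_block) (use that A in auto)
  have none: "(\<Sum>p<8. ?M ! p ! k * g p) = 2 * g k"
    if "k \<notin> set A" "k < 8" for k and g :: "nat \<Rightarrow> int"
    by (rule sum_no_block) (use that in auto)
  have mixed: "good ?M k l" if k: "k \<in> set A" and l: "l \<notin> set A" "l < 8" for k l
  proof -
    obtain a b c d where K: "A = [a, b, c, d]"
      using reg by (auto elim: regular_on.elims)
    have "quad ?M x k l = 2 * ((\<Sum>p\<leftarrow>A. of_bool (x p l)) - 2 * of_bool (x k l))"
      unfolding quad_def by (simp add: block[OF k] none[OF l] sum_list_const_mult)
    \<comment> \<open>If \<open>l\<close> has h neighbours in \<open>A\<close>, the value is 2h
      minus four times the adjacency of \<open>k\<close> and \<open>l\<close>: this is 0 for h = 0,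
      4 for h = 4, and complements the adjacency for h = 2.\<close>
    then show ?thesis
      using ev[of l] k l unfolding K by (auto simp: sym split: if_splits)
  qed
  consider "i \<in> set A" "j \<in> set A" | "i \<in> set A" "j \<notin> set A" | "i \<notin> set A" "j \<in> set A"
    | "i \<notin> set A" "j \<notin> set A" by blast
  then show ?thesis
  proof cases
    case 1
    then have "quad ?M x i j = 4 * of_bool (x i j)"
      unfolding quad_def block[OF 1(1)] block[OF 1(2)]
      using regular_block[OF reg 1] by simp
    then show ?thesis by (simp add: irrefl)
  next
    case 2
    then show ?thesis using mixed ij by blast
  next
    case 3
    then show ?thesis using mixed[of j i] ij quad_commute[of x ?M i j] sym by auto
  next
    case 4
    then show ?thesis
      unfolding quad_def none[OF 4(1) ij(1)] none[OF 4(2) ij(2)] by (simp add: irrefl)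
  qed
qed

lemma crossD:
  assumes "cross X" "i < 4" "j < 4"
  shows "4 * of_bool (X ! i ! j) + (\<Sum>i\<leftarrow>[0..<4]. \<Sum>j\<leftarrow>[0..<4]. of_bool (X ! i ! j)) -
    2 * ((\<Sum>j\<leftarrow>[0..<4]. of_bool (X ! i ! j)) + (\<Sum>i\<leftarrow>[0..<4]. of_bool (X ! i ! j))) \<in> {0, 4 :: int}"
proof -
  have mem: "i \<in> set [0..<4]" "j \<in> set [0..<4]" and "i < 4 - 0" "j < 4 - 0"
    using assms by auto
  then show ?thesis
    using assms(1)[unfolded cross_def Let_def list_all_iff, THEN bspec, OF mem(1), THEN bspec, OF mem(2)]
    by (simp only: nth_map_upt add_0)
qed

text \<open>Both diagonal blocks are fixed by regularity. The block between \<open>A\<close> and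
  \<open>C\<close> is multiplied by \<open>J / 2 - I\<close> on both sides, which is the situation
  described by \<open>cross\<close>.\<close>

lemma good_double_switch:
  assumes A: "double_switch x A C" "distinct A" "distinct C" "set A \<subseteq> {..<8}" "set C = {..<8} - set A"
    and ij: "i < 8" "j < 8"
  shows "good (switch_mat [A, C]) i j"
proof -
  let ?M = "switch_mat [A, C]"
  have reg: "regular_on x A" "regular_on x C" and cross: "cross (map (\<lambda>a. map (x a) C) A)"
    using A(1) by (simp_all add: double_switch_def)
  have blockA: "(\<Sum>p<8. ?M ! p ! k * g p) = (\<Sum>p\<leftarrow>A. g p) - 2 * g k"
    if "k \<in> set A" for k and g :: "nat \<Rightarrow> int"
    by (rule sum_block) (use that A in auto)
  have blockC: "(\<Sum>p<8. ?M ! p ! k * g p) = (\<Sum>p\<leftarrow>C. g p) - 2 * g k"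
    if "k \<in> set C" for k and g :: "nat \<Rightarrow> int"
    by (rule sum_block) (use that A in auto)
  have mixed: "good ?M k l" if k: "k \<in> set A" and l: "l \<in> set C" for k l
  proof -
    have len: "length A = 4" "length C = 4"
      using reg by (auto elim!: regular_on.elims(2))
    have nth: "(\<Sum>m\<leftarrow>[0..<4]. f (K ! m)) = (\<Sum>p\<leftarrow>K. f p)"
      if "length K = 4" for f :: "nat \<Rightarrow> int" and K
      using arg_cong[OF map_nth[of K], of "\<lambda>K. \<Sum>p\<leftarrow>K. f p"] that by (simp add: comp_def)
    obtain m n where m: "m < 4" "k = A ! m" and n: "n < 4" "l = C ! n"
      using k l len by (auto simp: in_set_conv_nth)
    let ?X = "map (\<lambda>a. map (x a) C) A"
    have X: "?X ! i ! j = x (A ! i) (C ! j)" if "i < 4" "j < 4" for i j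
      using that len by simp
    have row: "(\<Sum>j\<leftarrow>[0..<4]. of_bool (?X ! i ! j)) = (\<Sum>q\<leftarrow>C. of_bool (x (A ! i) q) :: int)"
      if "i < 4" for i
      unfolding nth[OF len(2), symmetric]
      by (intro arg_cong[of _ _ sum_list] map_cong refl) (use that X in auto)
    have col: "(\<Sum>i\<leftarrow>[0..<4]. of_bool (?X ! i ! j)) = (\<Sum>p\<leftarrow>A. of_bool (x p (C ! j)) :: int)"
      if "j < 4" for j
      unfolding nth[OF len(1), symmetric]
      by (intro arg_cong[of _ _ sum_list] map_cong refl) (use that X in auto)
    have total: "(\<Sum>i\<leftarrow>[0..<4]. \<Sum>j\<leftarrow>[0..<4]. of_bool (?X ! i ! j)) =
        (\<Sum>p\<leftarrow>A. \<Sum>q\<leftarrow>C. of_bool (x p q) :: int)"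
      unfolding nth[OF len(1), symmetric]
      by (intro arg_cong[of _ _ sum_list] map_cong refl row) auto
    have "4 * of_bool (x k l) + (\<Sum>p\<leftarrow>A. \<Sum>q\<leftarrow>C. of_bool (x p q)) -
        2 * ((\<Sum>q\<leftarrow>C. of_bool (x k q)) + (\<Sum>p\<leftarrow>A. of_bool (x p l))) \<in> {0, 4 :: int}"
      using crossD[OF cross m(1) n(1)]
      unfolding total row[OF m(1)] col[OF n(1)] X[OF m(1) n(1)] m(2) n(2) .
    moreover have "quad ?M x k l = 4 * of_bool (x k l) + (\<Sum>p\<leftarrow>A. \<Sum>q\<leftarrow>C. of_bool (x p q)) -
        2 * ((\<Sum>q\<leftarrow>C. of_bool (x k q)) + (\<Sum>p\<leftarrow>A. of_bool (x p l)))"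
      unfolding quad_def blockA[OF k] blockC[OF l]
      by (simp add: sum_list_subtractf sum_list_const_mult algebra_simps)
    moreover have "k \<noteq> l" using k l A(5) by auto
    ultimately show ?thesis by simp
  qed
  consider "i \<in> set A" "j \<in> set A" | "i \<in> set A" "j \<in> set C" | "i \<in> set C" "j \<in> set A"
    | "i \<in> set C" "j \<in> set C" using A(5) ij by blast
  then show ?thesis
  proof cases
    case 1
    then have "quad ?M x i j = 4 * of_bool (x i j)"
      unfolding quad_def blockA[OF 1(1)] blockA[OF 1(2)]
      using regular_block[OF reg(1) 1] by simp
    then show ?thesis by (simp add: irrefl)
  next
    case 2
    then show ?thesis using mixed by blast
  next
    case 3
    then show ?thesis using mixed[of j i] quad_commute[of x ?M i j] sym by auto
  next
    case 4
    then have "quad ?M x i j = 4 * of_bool (x i j)"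
      unfolding quad_def blockC[OF 4(1)] blockC[OF 4(2)]
      using regular_block[OF reg(2) 4] by simp
    then show ?thesis by (simp add: irrefl)
  qed
qed

end

section \<open>Factorizations\<close>

text \<open>The supports of the twelve candidates for \<open>P\<close>; the head of each list is a
  set along which \<open>P\<close> splits.\<close>

definition blocks :: "nat list list list" where
  "blocks = concat (map (\<lambda>(A, C). [[A], [C], [A, C]]) planes)"

lemma planes_partition:
  assumes "(A, C) \<in> set planes"
  shows "distinct A" "distinct C" "set A \<subseteq> {..<8}" "set C = {..<8} - set A"
    "set C \<subseteq> {..<8}" "set A = {..<8} - set C"
proof -
  have "list_all (\<lambda>(A, C). distinct A \<and> distinct C \<and>
      set A \<union> set C = set [0..<8] \<and> set A \<inter> set C = {}) planes"
    by code_simp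
  then have "distinct A" "distinct C" "set A \<union> set C = {..<8}" "set A \<inter> set C = {}"
    using assms unfolding list_all_iff by (auto simp: atLeast0LessThan)
  then show "distinct A" "distinct C" "set A \<subseteq> {..<8}" "set C = {..<8} - set A"
    "set C \<subseteq> {..<8}" "set A = {..<8} - set C"
    by blast+
qed

lemma (in graph) ex_good_blocks:
  assumes "\<And>i j. i < 8 \<Longrightarrow> j < 8 \<Longrightarrow> good cube i j"
  shows "\<exists>As\<in>set blocks. \<forall>i<8. \<forall>j<8. good (switch_mat As) i j"
proof -
  \<comment> \<open>On the diagonal \<open>quad\<close> is twice \<open>edge_sum\<close>, but there
    both have to vanish.\<close>
  have "admissible cube x i j" if "i < 8" "j < 8" for i j
    using assms[OF that] unfolding admissible_def
    by (auto simp: quad_eq_edge_sum[of x, OF sym irrefl] split: if_splits)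
  then have "switchable x"
    using sym by (rule switchable_if_admissible[rotated])
  then obtain A C where AC: "(A, C) \<in> set planes"
    and "single_switch x A C \<or> single_switch x C A \<or> double_switch x A C"
    by (auto simp: switchable_def list_ex_iff)
  moreover have "[A] \<in> set blocks" "[C] \<in> set blocks" "[A, C] \<in> set blocks"
    using AC by (auto simp: blocks_def)
  ultimately show ?thesis
    using good_single_switch[of A C] good_single_switch[of C A] good_double_switch[of A C]
      planes_partition[OF AC] by blast
qed

text \<open>Twice \<open>P\<^sup>T R_cube\<close>: the product of the two doubled matrices carries a
  factor 4, half of which is divided out.\<close>

definition quotient :: "int list list \<Rightarrow> int list list" where
  "quotient M = map (\<lambda>i. map (\<lambda>j. (\<Sum>k\<leftarrow>[0..<8]. M ! k ! i * cube ! k ! j) div 2) [0..<8]) [0..<8]"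

definition codewords :: "int list list" where
  "codewords = filter (\<lambda>v. list_all (\<lambda>j. (\<Sum>k\<leftarrow>[0..<8]. cube ! k ! j * v ! k) \<in> {0, 2}) [0..<8])
     (List.n_lists 8 [0, 1])"

definition preserves_codewords :: "int list list \<Rightarrow> bool" where
  "preserves_codewords M \<longleftrightarrow>
     list_all (\<lambda>v. list_all (\<lambda>j. (\<Sum>k\<leftarrow>[0..<8]. M ! k ! j * v ! k) \<in> {0, 2}) [0..<8]) codewords"

text \<open>The left factor splits along \<open>A\<close>, whereas the right factor splits off a
  single entry, whose position is searched for.\<close>

definition factorization :: "nat list \<Rightarrow> int list list \<Rightarrow> int list list \<Rightarrow> bool" where
  "factorization A M N \<longleftrightarrow> orthogonal_entries M \<and> orthogonal_entries N \<and>
     splits M A A \<and> list_ex (\<lambda>r. list_ex (\<lambda>c. splits N [r] [c]) [0..<8]) [0..<8] \<and>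
     list_all (\<lambda>i. list_all (\<lambda>j.
       (\<Sum>k\<leftarrow>[0..<8]. M ! i ! k * N ! k ! j) = 2 * cube ! i ! j) [0..<8]) [0..<8] \<and>
     preserves_codewords M"

lemma factorizations:
  "list_all (\<lambda>As. factorization (hd As) (switch_mat As) (quotient (switch_mat As))) blocks"
  by code_simp

text \<open>Read as an integer list, \<open>v\<close> is among the enumerated codewords, so the
  finite check applies to it.\<close>

lemma zero_one_vec_if_preserves_codewords:
  assumes M: "preserves_codewords M" and v: "v \<in> V_set R_cube"
  shows "zero_one_vec (transpose_mat (half_mat M) *\<^sub>v v)"
proof -
  define w where "w = map (\<lambda>k. if v $ k = 1 then 1 else 0 :: int) [0..<8]"
  have dim: "dim_vec v = 8" and v01: "\<And>k. k < 8 \<Longrightarrow> v $ k \<in> {0, 1}"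
    using v by (auto simp: V_set_def R_cube_eq zero_one_vec_def)
  have w: "v $ k = of_int (w ! k)" if "k < 8" for k
    using v01[OF that] that by (auto simp: w_def)
  have product: "(transpose_mat (half_mat N) *\<^sub>v v) $ j = of_int (\<Sum>k\<leftarrow>[0..<8]. N ! k ! j * w ! k) / 2"
    if "j < 8" for N j
    unfolding sum_upt8 using that dim
    by (simp add: scalar_prod_def atLeast0LessThan sum_divide_distrib w)
  have in_01: "(of_int s / 2 :: rat) \<in> {0, 1} \<longleftrightarrow> s \<in> {0, 2}" for s :: int
    by (auto simp: divide_eq_eq)
  have "w \<in> set (List.n_lists 8 [0, 1])"
    by (auto simp: w_def set_n_lists)
  moreover have "(\<Sum>k\<leftarrow>[0..<8]. cube ! k ! j * w ! k) \<in> {0, 2}" if "j < 8" for j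
  proof -
    have "(transpose_mat (half_mat cube) *\<^sub>v v) $ j \<in> {0, 1}"
      using v that by (simp add: V_set_def R_cube_eq zero_one_vec_def)
    then show ?thesis
      unfolding product[OF that] in_01 .
  qed
  ultimately have "w \<in> set codewords"
    unfolding codewords_def set_filter list_all_iff set_upt by auto
  then have sum: "(\<Sum>k\<leftarrow>[0..<8]. M ! k ! j * w ! k) \<in> {0, 2}" if "j < 8" for j
    using M that unfolding preserves_codewords_def list_all_iff set_upt
    by (meson atLeastLessThan_iff zero_le)
  have "(transpose_mat (half_mat M) *\<^sub>v v) $ j \<in> {0, 1}" if "j < 8" for j
    unfolding product[OF that] in_01 by (rule sum[OF that])
  then show ?thesis
    unfolding zero_one_vec_def dim_mult_mat_vec index_transpose_mat dim_half_mat by blast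
qed

section \<open>Congruence of \<open>B\<close> and of the bordered matrix\<close>

lemma congruence_eq_quad:
  assumes B: "B \<in> carrier_mat 8 8"
    and x: "\<And>p q. p < 8 \<Longrightarrow> q < 8 \<Longrightarrow> B $$ (p, q) = of_bool (x p q)"
    and ij: "i < 8" "j < 8"
  shows "(transpose_mat (half_mat M) * B * half_mat M) $$ (i, j) = of_int (quad M x i j) / 4"
proof -
  have "(transpose_mat (half_mat M) * B * half_mat M) $$ (i, j) =
      (transpose_mat (half_mat M) * (B * half_mat M)) $$ (i, j)"
    using B by (subst assoc_mult_mat[of _ 8 8 _ 8 _ 8]) auto
  also have "\<dots> = (\<Sum>p<8. of_int (M ! p ! i) / 2 *
      (\<Sum>q<8. of_bool (x p q) * (of_int (M ! q ! j) / 2)))"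
    using B ij by (simp add: scalar_prod_def atLeast0LessThan x)
  also have "\<dots> = of_int (quad M x i j) / 4"
    by (simp only: quad_def of_int_sum of_int_mult of_int_of_bool sum_divide_distrib sum_distrib_left)
      (intro sum.cong refl, simp add: mult_ac)
  finally show ?thesis .
qed

text \<open>Symmetry is automatic, and the entries 0 and 1 correspond to the values 0 and 4 of
  \<open>quad\<close>. With \<open>cube\<close> this reads off the hypothesis on \<open>B\<close>,
  with a switching matrix it gives the conclusion.\<close>

lemma (in graph) adjacency_congruence_iff:
  assumes B: "B \<in> carrier_mat 8 8" "transpose_mat B = B"
    and x: "\<And>p q. p < 8 \<Longrightarrow> q < 8 \<Longrightarrow> B $$ (p, q) = of_bool (x p q)"
  shows "adjacency_mat (transpose_mat (half_mat M) * B * half_mat M) \<longleftrightarrow>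
    (\<forall>i<8. \<forall>j<8. good M i j)"
proof -
  let ?C = "transpose_mat (half_mat M) * B * half_mat M"
  have C: "?C \<in> carrier_mat 8 8"
    using B by (intro mult_carrier_mat) auto
  have entry: "?C $$ (i, j) = of_int (quad M x i j) / 4" if "i < 8" "j < 8" for i j
    using congruence_eq_quad[OF B(1) x that] .
  have sym_C: "transpose_mat ?C = ?C"
    using C by (intro eq_matI) (auto simp: entry quad_commute[OF sym] simp del: index_mult_mat)
  have 0: "(of_int s / 4 :: rat) = 0 \<longleftrightarrow> s = 0"
    and 1: "(of_int s / 4 :: rat) = 1 \<longleftrightarrow> s = 4" for s :: int
    by (auto simp: divide_eq_eq)
  have "adjacency_mat ?C \<longleftrightarrow> (\<forall>i<8. \<forall>j<8. ?C $$ (i, j) \<in> {0, 1}) \<and> (\<forall>i<8. ?C $$ (i, i) = 0)"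
    using C sym_C by (auto simp: adjacency_mat_def zero_one_mat_def simp del: index_mult_mat)
  also have "\<dots> \<longleftrightarrow> (\<forall>i<8. \<forall>j<8. good M i j)"
    by (auto simp: entry 0 1 simp del: index_mult_mat)
  finally show ?thesis .
qed

lemma adjacency_four_blockI:
  assumes "X \<in> carrier_mat n n" "U \<in> carrier_mat n m" "W \<in> carrier_mat m m"
    and X: "adjacency_mat X" and W: "adjacency_mat W"
    and U: "\<And>j. j < m \<Longrightarrow> zero_one_vec (col U j)"
  shows "adjacency_mat (four_block_mat X U (transpose_mat U) W)"
  unfolding adjacency_mat_def
proof (intro conjI)
  show "transpose_mat (four_block_mat X U (transpose_mat U) W) = four_block_mat X U (transpose_mat U) W"
    using assms by (subst transpose_four_block_mat) (auto simp: adjacency_mat_def)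
  have "U $$ (i, j) \<in> {0, 1}" if "i < n" "j < m" for i j
    using U[OF that(2)] that assms(2) by (auto simp: zero_one_vec_def)
  then show "zero_one_mat (four_block_mat X U (transpose_mat U) W)"
    using assms by (auto simp: adjacency_mat_def zero_one_mat_def)
qed (use assms in \<open>auto simp: adjacency_mat_def\<close>)

lemma adjacency_four_blockD:
  assumes "B \<in> carrier_mat n n" "V \<in> carrier_mat n m" "W \<in> carrier_mat m m"
    and A: "adjacency_mat (four_block_mat B V (transpose_mat V) W)"
  shows "adjacency_mat W"
proof -
  let ?A = "four_block_mat B V (transpose_mat V) W"
  have entry: "W $$ (i, j) = ?A $$ (i + n, j + n)" if "i < m" "j < m" for i j
    using assms(1-3) that by auto
  have sym: "?A $$ (i, j) = ?A $$ (j, i)" if "i < n + m" "j < n + m" for i j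
  proof -
    have "transpose_mat ?A $$ (i, j) = ?A $$ (j, i)"
      using that assms(1-3) by (intro index_transpose_mat) auto
    then show ?thesis
      using A by (simp only: adjacency_mat_def)
  qed
  have "\<forall>i<n + m. \<forall>j<n + m. ?A $$ (i, j) \<in> {0, 1}" "\<forall>i<n + m. ?A $$ (i, i) = 0"
    using A assms(1-3) unfolding adjacency_mat_def zero_one_mat_def by auto
  then have "W $$ (i, j) \<in> {0, 1}" "W $$ (i, i) = 0" "W $$ (i, j) = W $$ (j, i)"
    if "i < m" "j < m" for i j
    using that sym[of "i + n" "j + n"] unfolding entry[OF that] entry[OF that(1,1)] entry[OF that(2,1)]
    by simp_all
  then show ?thesis
    using assms(3) by (auto simp: adjacency_mat_def zero_one_mat_def intro!: eq_matI)
qed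

text \<open>The identity block of \<open>Q\<close> leaves \<open>W\<close> unchanged, so only
  \<open>B\<close> and the columns of \<open>V\<close> are transformed.\<close>

lemma congruence_four_block:
  fixes S B V W :: "rat mat"
  assumes S: "S \<in> carrier_mat n n" and B: "B \<in> carrier_mat n n"
    and V: "V \<in> carrier_mat n m" and W: "W \<in> carrier_mat m m"
  defines "Q \<equiv> four_block_mat S (0\<^sub>m n m) (0\<^sub>m m n) (1\<^sub>m m)"
  shows "transpose_mat Q * four_block_mat B V (transpose_mat V) W * Q =
    four_block_mat (transpose_mat S * B * S) (transpose_mat S * V) (transpose_mat (transpose_mat S * V)) W"
proof -
  have "transpose_mat Q = four_block_mat (transpose_mat S) (0\<^sub>m n m) (0\<^sub>m m n) (1\<^sub>m m)"
    unfolding Q_def using S by (subst transpose_four_block_mat) auto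
  moreover have "four_block_mat (transpose_mat S) (0\<^sub>m n m) (0\<^sub>m m n) (1\<^sub>m m) *
      four_block_mat B V (transpose_mat V) W =
      four_block_mat (transpose_mat S * B) (transpose_mat S * V) (transpose_mat V) W"
    using S B V W left_mult_one_mat[of "transpose_mat V" m n] left_mult_one_mat[OF W]
      left_add_zero_mat[of "transpose_mat V" m n] left_add_zero_mat[OF W]
    by (subst mult_four_block_mat[of _ n n _ m _ m _ _ n _ m]) auto
  moreover have "four_block_mat (transpose_mat S * B) (transpose_mat S * V) (transpose_mat V) W * Q =
      four_block_mat (transpose_mat S * B * S) (transpose_mat S * V) (transpose_mat V * S) W"
    unfolding Q_def using S B V W right_mult_one_mat[OF W] left_add_zero_mat[OF W]
      right_mult_one_mat[of "transpose_mat S * V" n m]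
    by (subst mult_four_block_mat[of _ n n _ m _ m _ _ n _ m]) auto
  moreover have "transpose_mat V * S = transpose_mat (transpose_mat S * V)"
    using S V by (subst transpose_mult) auto
  ultimately show ?thesis by simp
qed

theorem theorem29:
  fixes B :: "rat mat"
  assumes "B \<in> B_set R_cube"
  shows "reducible_wrt R_cube B"
proof -
  have B: "B \<in> carrier_mat 8 8" and adj: "adjacency_mat B"
    and adj_cube: "adjacency_mat (transpose_mat (half_mat cube) * B * half_mat cube)"
    using assms by (auto simp: B_set_def R_cube_eq)
  \<comment> \<open>The bounds make \<open>x\<close> symmetric and irreflexive on all natural
    numbers, as the locale demands.\<close>
  define x where "x p q \<longleftrightarrow> p < 8 \<and> q < 8 \<and> B $$ (p, q) = 1" for p q
  have sym_B: "transpose_mat B = B"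
    using adj by (simp add: adjacency_mat_def)
  have "B $$ (p, q) = B $$ (q, p)" if "p < 8" "q < 8" for p q
    using arg_cong[OF sym_B, of "\<lambda>B. B $$ (p, q)"] that B by simp
  then interpret graph x
    using adj B by unfold_locales (auto simp: x_def adjacency_mat_def)
  have entry: "B $$ (p, q) = of_bool (x p q)" if "p < 8" "q < 8" for p q
    using adj B that by (auto simp: x_def adjacency_mat_def zero_one_mat_def)
  have "\<And>i j. i < 8 \<Longrightarrow> j < 8 \<Longrightarrow> good cube i j"
    using adj_cube adjacency_congruence_iff[OF B sym_B entry, of cube] by blast
  then obtain As where As: "As \<in> set blocks" and "\<forall>i<8. \<forall>j<8. good (switch_mat As) i j"
    using ex_good_blocks by blast
  define M where "M = switch_mat As"
  define N where "N = quotient M"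
  have adj_M: "adjacency_mat (transpose_mat (half_mat M) * B * half_mat M)"
    using \<open>\<forall>i<8. \<forall>j<8. good (switch_mat As) i j\<close>
    using adjacency_congruence_iff[OF B sym_B entry, of M] unfolding M_def by blast
  have MN: "factorization (hd As) M N"
    using factorizations As unfolding list_all_iff M_def N_def by blast
  then have orth: "orthogonal_entries M" "orthogonal_entries N" and pres: "preserves_codewords M"
    by (simp_all only: factorization_def)
  have dec_M: "decomposable_mat (half_mat M)"
    using MN unfolding factorization_def by (blast intro: decomposable_half_mat)
  have dec_N: "decomposable_mat (half_mat N)"
    using MN by (auto simp only: factorization_def list_ex_iff intro: decomposable_half_mat)
  have prod: "(\<Sum>k<8. M ! i ! k * N ! k ! j) = 2 * cube ! i ! j" if "i < 8" "j < 8" for i j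
    using MN that unfolding factorization_def list_all_iff set_upt sum_upt8
    by (meson atLeastLessThan_iff zero_le)
  have R: "R_cube = half_mat M * half_mat N"
    unfolding R_cube_eq
  proof (rule eq_matI)
    fix i j assume "i < dim_row (half_mat M * half_mat N)" "j < dim_col (half_mat M * half_mat N)"
    then have ij: "i < 8" "j < 8" by simp_all
    show "half_mat cube $$ (i, j) = (half_mat M * half_mat N) $$ (i, j)"
      unfolding half_mat_times(1)[OF ij] prod[OF ij] using ij by simp
  qed simp_all
  have A: "adjacency_mat (transpose_mat Q * four_block_mat B V (transpose_mat V) W * Q)"
    if V: "V \<in> carrier_mat 8 m" and W: "W \<in> carrier_mat m m" and cols: "set (cols V) \<subseteq> V_set R_cube"
      and adj_A: "adjacency_mat (four_block_mat B V (transpose_mat V) W)"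
      and Q: "Q = four_block_mat (half_mat M) (0\<^sub>m 8 m) (0\<^sub>m m 8) (1\<^sub>m m)" for m V W Q
  proof -
    have "zero_one_vec (col (transpose_mat (half_mat M) * V) j)" if "j < m" for j
    proof -
      have "col V j \<in> V_set R_cube"
        using cols V that by (auto simp: cols_def)
      then show ?thesis
        using zero_one_vec_if_preserves_codewords[OF pres] V that
        by (subst col_mult2[of _ 8 8 _ m]) auto
    qed
    then show ?thesis
      unfolding Q congruence_four_block[OF half_mat_carrier B V W]
      using V W B adj_M adjacency_four_blockD[OF B V W adj_A]
      by (intro adjacency_four_blockI[of _ 8 _ m]) (auto intro!: mult_carrier_mat)
  qed
  have dim: "dim_row R_cube = 8"
    by (simp add: R_cube_eq)
  show ?thesis
    unfolding reducible_wrt_def dim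
  proof (intro conjI exI[of _ "[half_mat M, half_mat N]"] allI impI)
    show "regular_orthogonal_mat R_cube" "\<not> decomposable_mat R_cube" "level R_cube = 2"
      by (rule regular_orthogonal_R_cube indecomposable_R_cube level_R_cube)+
    show "B \<in> B_set R_cube" by fact
    show "\<forall>S\<in>set [half_mat M, half_mat N]. S \<in> carrier_mat 8 8 \<and>
        regular_orthogonal_mat S \<and> decomposable_mat S \<and> level S \<le> 2"
      using orth dec_M dec_N by (simp add: regular_orthogonal_half_mat level_half_mat)
    show "R_cube = mat_list_prod 8 [half_mat M, half_mat N]"
      by (simp add: R mat_list_prod_def)
    fix i m V W
    assume *: "1 \<le> i \<and> i < length [half_mat M, half_mat N] \<and> V \<in> carrier_mat 8 m \<and>
      W \<in> carrier_mat m m \<and> set (cols V) \<subseteq> V_set R_cube \<and>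
      adjacency_mat (four_block_mat B V (transpose_mat V) W)"
    \<comment> \<open>The list has length 2, so \<open>i = 1\<close> and the only proper initial
      product is \<open>P\<close> itself, bordered by the identity.\<close>
    then have "take i [half_mat M, half_mat N] = [half_mat M]"
      by (cases i) auto
    moreover have "four_block_mat (half_mat M) (0\<^sub>m 8 m) (0\<^sub>m m 8) (1\<^sub>m m) * 1\<^sub>m (8 + m) =
        four_block_mat (half_mat M) (0\<^sub>m 8 m) (0\<^sub>m m 8) (1\<^sub>m m)"
      by (intro right_mult_one_mat) auto
    ultimately show "let A = four_block_mat B V (transpose_mat V) W;
         Q = mat_list_prod (8 + m) (map (\<lambda>S. four_block_mat S (0\<^sub>m 8 m) (0\<^sub>m m 8) (1\<^sub>m m))
           (take i [half_mat M, half_mat N]))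
       in adjacency_mat (transpose_mat Q * A * Q)"
      using A * by (simp only: Let_def mat_list_prod_def list.map foldr.simps comp_def id_def)
  qed
qed

end
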